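(* Let $\Delta$ be an additive subgroup of $\mathbb{C}$, and let $\mathcal{A}=\mathcal{A}_{\Delta,\{0\}}$ be the complex vector space with basis $\{x_\alpha\mid\alpha\in\Delta\}$ and Novikov product $x_\alpha\circ x_\beta=\beta x_{\alpha+\beta}$ (the case $b=0$). (i) Any Lie algebra $(\mathcal{A},[\cdot,\cdot])$ over the Novikov algebra $(\mathcal{A},\circ)$ has its Lie bracket of the form $$[x_\alpha,x_\beta]=(\phi(\alpha,\beta)+a(\beta-\alpha))x_{\alpha+\beta}\qquad\text{for }\alpha,\beta\in\Delta,\qquad(1)$$ where $a\in\mathbb{C}$ is a constant and $\phi:\Delta\times\Delta\to\mathbb{C}$ is a skew-symmetric map for which there exists a symmetric map $S_0:\Delta\times\Delta\times\Delta\to\mathbb{C}$ such that for all $\alpha,\beta,\gamma\in\Delta$ $$\phi(\beta+\gamma,\alpha)=\phi(\gamma,\alpha)+\phi(\beta,\alpha)+\alpha S_0(\alpha,\beta,\gamma),\qquad(2)$$ $$\big(\gamma\phi(\alpha,\beta)+\alpha\phi(\beta,\gamma)+\beta\phi(\gamma,\alpha)\big)\big(S_0(\alpha,\beta,\gamma)-a\big)=0.\qquad(3)$$ (ii) Conversely, for any constant $a\in\mathbb{C}$ and any skew-symmetric map $\phi:\Delta\times\Delta\to\mathbb{C}$ for which there exists a symmetric map $S_0:\Delta\times\Delta\times\Delta\to\mathbb{C}$ satisfying (2) and (3), the bracket (1) defines a Lie algebra over the Novikov algebra $(\mathcal{A},\circ)$. (iii) In particular, the following $\phi$ satisfy the condition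 in (ii): when $a=0$, any skew-symmetric $\mathbb{Z}$-bilinear form $\phi:\Delta\times\Delta\to\mathbb{C}$; when $a\neq0$, any $\phi(\alpha,\beta)=\alpha\varphi_0(\beta)-\beta\varphi_0(\alpha)$ where $\varphi_0:\Delta\to\mathbb{C}$ is a homomorphism of additive groups.
   Context: A Novikov algebra $(\mathcal{A},\circ)$ (over $\mathbb{C}$) satisfies $(u\circ v)\circ w=(u\circ w)\circ v$ and $(u,v,w)=(v,u,w)$, where $(u,v,w)=(u\circ v)\circ w-u\circ(v\circ w)$. A Gel'fand-Dorfman bialgebra is a triple $(\mathcal{A},[\cdot,\cdot],\circ)$ such that $(\mathcal{A},[\cdot,\cdot])$ is a Lie algebra, $(\mathcal{A},\circ)$ is a Novikov algebra and $$[w\circ u,v]-[w\circ v,u]+[w,u]\circ v-[w,v]\circ u-w\circ[u,v]=0\quad\text{for all }u,v,w\in\mathcal{A}.$$ "$(\mathcal{A},[\cdot,\cdot])$ is a Lie algebra over the Novikov algebra $(\mathcal{A},\circ)$" means that $(\mathcal{A},[\cdot,\cdot],\circ)$ is a Gel'fand-Dorfman bialgebra. A map on $\Delta\times\Delta\times\Delta$ is symmetric if it is invariant under all permutations of its three arguments; $\phi$ is skew-symmetric if $\phi(\alpha,\beta)=-\phi(\beta,\alpha)$. *)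

theory Defs
  imports Complex_Main
begin

text \<open>Algebras live on a subspace \<open>A\<close> of an ambient complex vector space \<open>'v\<close>, because the
  space \<open>A\<close> below depends on the group \<open>\<Delta>\<close>. Products are total functions on \<open>'v\<close>, but all laws
  concern only their values on \<open>A\<close>.\<close>

locale complex_algebra = vector_space scale
  for scale :: "complex \<Rightarrow> 'v::ab_group_add \<Rightarrow> 'v" +
  fixes A :: "'v set" and mul :: "'v \<Rightarrow> 'v \<Rightarrow> 'v"
  assumes subspace_carrier: "subspace A"
    and mul_closed: "u \<in> A \<Longrightarrow> v \<in> A \<Longrightarrow> mul u v \<in> A"
    and mul_add_left: "u \<in> A \<Longrightarrow> v \<in> A \<Longrightarrow> w \<in> A \<Longrightarrow> mul (u + v) w = mul u w + mul v w"
    and mul_add_right: "u \<in> A \<Longrightarrow> v \<in> A \<Longrightarrow> w \<in> A \<Longrightarrow> mul u (v + w) = mul u v + mul u w"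
    and mul_scale_left: "u \<in> A \<Longrightarrow> v \<in> A \<Longrightarrow> mul (scale c u) v = scale c (mul u v)"
    and mul_scale_right: "u \<in> A \<Longrightarrow> v \<in> A \<Longrightarrow> mul u (scale c v) = scale c (mul u v)"

definition associator :: "('v::ab_group_add \<Rightarrow> 'v \<Rightarrow> 'v) \<Rightarrow> 'v \<Rightarrow> 'v \<Rightarrow> 'v \<Rightarrow> 'v" where
  "associator mul u v w = mul (mul u v) w - mul u (mul v w)"

locale novikov_algebra = complex_algebra scale A circ
  for scale :: "complex \<Rightarrow> 'v::ab_group_add \<Rightarrow> 'v" and A circ +
  assumes right_commute: "u \<in> A \<Longrightarrow> v \<in> A \<Longrightarrow> w \<in> A \<Longrightarrow> circ (circ u v) w = circ (circ u w) v"
    and left_symmetric: "u \<in> A \<Longrightarrow> v \<in> A \<Longrightarrow> w \<in> A \<Longrightarrow>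
      associator circ u v w = associator circ v u w"

locale lie_algebra = complex_algebra scale A br
  for scale :: "complex \<Rightarrow> 'v::ab_group_add \<Rightarrow> 'v" and A br +
  assumes alternating: "u \<in> A \<Longrightarrow> br u u = 0"
    and jacobi: "u \<in> A \<Longrightarrow> v \<in> A \<Longrightarrow> w \<in> A \<Longrightarrow>
      br u (br v w) + br v (br w u) + br w (br u v) = 0"

locale gelfand_dorfman_bialgebra =
  lie: lie_algebra scale A br + novikov: novikov_algebra scale A circ
  for scale :: "complex \<Rightarrow> 'v::ab_group_add \<Rightarrow> 'v" and A br circ +
  assumes compatible: "u \<in> A \<Longrightarrow> v \<in> A \<Longrightarrow> w \<in> A \<Longrightarrow>
    br (circ w u) v - br (circ w v) u + circ (br w u) v - circ (br w v) u - circ w (br u v) = 0"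

definition additive_subgroup_of_complex :: "complex set \<Rightarrow> bool" where
  "additive_subgroup_of_complex \<Delta> \<longleftrightarrow>
    0 \<in> \<Delta> \<and> (\<forall>\<alpha>\<in>\<Delta>. \<forall>\<beta>\<in>\<Delta>. \<alpha> + \<beta> \<in> \<Delta>) \<and> (\<forall>\<alpha>\<in>\<Delta>. - \<alpha> \<in> \<Delta>)"

text \<open>The algebra \<open>\<A>\<^bsub>\<Delta>,{0}\<^esub>\<close>: \<open>A\<close> has basis \<open>x \<alpha>\<close>, \<open>\<alpha> \<in> \<Delta>\<close>, and \<open>circ\<close> is the bilinear
  product determined on \<open>A\<close> by its values on the basis.\<close>

locale novikov_Delta = complex_algebra scale A circ
  for scale :: "complex \<Rightarrow> 'v::ab_group_add \<Rightarrow> 'v" and A circ +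
  fixes \<Delta> :: "complex set" and x :: "complex \<Rightarrow> 'v"
  assumes subgroup_Delta: "additive_subgroup_of_complex \<Delta>"
    and inj_basis: "inj_on x \<Delta>"
    and independent_basis: "independent (x ` \<Delta>)"
    and span_basis: "span (x ` \<Delta>) = A"
    and circ_basis: "\<alpha> \<in> \<Delta> \<Longrightarrow> \<beta> \<in> \<Delta> \<Longrightarrow> circ (x \<alpha>) (x \<beta>) = scale \<beta> (x (\<alpha> + \<beta>))"

text \<open>Maps on \<open>\<Delta>\<close>, \<open>\<Delta> \<times> \<Delta>\<close> and \<open>\<Delta> \<times> \<Delta> \<times> \<Delta>\<close> are represented by total curried functions, of which
  only the values at arguments in \<open>\<Delta>\<close> matter.\<close>

definition skew_symmetric_on :: "complex set \<Rightarrow> (complex \<Rightarrow> complex \<Rightarrow> complex) \<Rightarrow> bool" where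
  "skew_symmetric_on \<Delta> \<phi> \<longleftrightarrow> (\<forall>\<alpha>\<in>\<Delta>. \<forall>\<beta>\<in>\<Delta>. \<phi> \<alpha> \<beta> = - \<phi> \<beta> \<alpha>)"

definition symmetric3_on ::
    "complex set \<Rightarrow> (complex \<Rightarrow> complex \<Rightarrow> complex \<Rightarrow> complex) \<Rightarrow> bool" where
  "symmetric3_on \<Delta> S \<longleftrightarrow> (\<forall>\<alpha>\<in>\<Delta>. \<forall>\<beta>\<in>\<Delta>. \<forall>\<gamma>\<in>\<Delta>.
    S \<alpha> \<beta> \<gamma> = S \<alpha> \<gamma> \<beta> \<and> S \<alpha> \<beta> \<gamma> = S \<beta> \<alpha> \<gamma> \<and> S \<alpha> \<beta> \<gamma> = S \<beta> \<gamma> \<alpha> \<and>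
    S \<alpha> \<beta> \<gamma> = S \<gamma> \<alpha> \<beta> \<and> S \<alpha> \<beta> \<gamma> = S \<gamma> \<beta> \<alpha>)"

definition admissible ::
    "complex set \<Rightarrow> complex \<Rightarrow> (complex \<Rightarrow> complex \<Rightarrow> complex) \<Rightarrow> bool" where
  "admissible \<Delta> a \<phi> \<longleftrightarrow> skew_symmetric_on \<Delta> \<phi> \<and>
    (\<exists>S. symmetric3_on \<Delta> S \<and>
      (\<forall>\<alpha>\<in>\<Delta>. \<forall>\<beta>\<in>\<Delta>. \<forall>\<gamma>\<in>\<Delta>.
        \<phi> (\<beta> + \<gamma>) \<alpha> = \<phi> \<gamma> \<alpha> + \<phi> \<beta> \<alpha> + \<alpha> * S \<alpha> \<beta> \<gamma> \<and>
        (\<gamma> * \<phi> \<alpha> \<beta> + \<alpha> * \<phi> \<beta> \<gamma> + \<beta> * \<phi> \<gamma> \<alpha>) * (S \<alpha> \<beta> \<gamma> - a) = 0))"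

definition has_bracket_form ::
    "(complex \<Rightarrow> 'v \<Rightarrow> 'v) \<Rightarrow> complex set \<Rightarrow> (complex \<Rightarrow> 'v) \<Rightarrow> complex \<Rightarrow>
     (complex \<Rightarrow> complex \<Rightarrow> complex) \<Rightarrow> ('v \<Rightarrow> 'v \<Rightarrow> 'v) \<Rightarrow> bool" where
  "has_bracket_form scale \<Delta> x a \<phi> br \<longleftrightarrow> (\<forall>\<alpha>\<in>\<Delta>. \<forall>\<beta>\<in>\<Delta>.
    br (x \<alpha>) (x \<beta>) = scale (\<phi> \<alpha> \<beta> + a * (\<beta> - \<alpha>)) (x (\<alpha> + \<beta>)))"

definition additive_map_on :: "complex set \<Rightarrow> (complex \<Rightarrow> complex) \<Rightarrow> bool" where
  "additive_map_on \<Delta> f \<longleftrightarrow> (\<forall>\<alpha>\<in>\<Delta>. \<forall>\<beta>\<in>\<Delta>. f (\<alpha> + \<beta>) = f \<alpha> + f \<beta>)"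

text \<open>A map of abelian groups is \<open>\<int>\<close>-linear iff it is additive.\<close>

definition Z_bilinear_on :: "complex set \<Rightarrow> (complex \<Rightarrow> complex \<Rightarrow> complex) \<Rightarrow> bool" where
  "Z_bilinear_on \<Delta> \<phi> \<longleftrightarrow>
    (\<forall>\<gamma>\<in>\<Delta>. additive_map_on \<Delta> (\<lambda>\<alpha>. \<phi> \<alpha> \<gamma>)) \<and> (\<forall>\<gamma>\<in>\<Delta>. additive_map_on \<Delta> (\<phi> \<gamma>))"

end

theory Submission
  imports Defs
begin

text \<open>Write \<open>[x \<alpha>, x \<beta>] = \<Sum> c\<^sub>\<theta>(\<alpha>, \<beta>) x (\<alpha> + \<beta> + \<theta>)\<close>. Comparing coefficients, the compatibility
  condition splits into one functional equation for each \<open>\<theta>\<close>. Specialising its third argument to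
  \<open>0\<close> gives \<open>\<theta> c\<^sub>\<theta>(\<alpha>, \<beta>) = \<beta> c\<^sub>\<theta>(0, \<alpha>) - \<alpha> c\<^sub>\<theta>(0, \<beta>)\<close>. Hence \<open>c\<^sub>\<theta> = 0\<close> for \<open>\<theta> \<noteq> 0\<close>, and
  \<open>c\<^sub>0(0, \<beta>) = a \<beta>\<close> for a constant \<open>a\<close>. For \<open>\<phi>(\<alpha>, \<beta>) = c\<^sub>0(\<alpha>, \<beta>) - a (\<beta> - \<alpha>)\<close> the equation
  says exactly that the additivity defect of \<open>\<phi>\<close>, divided by \<open>\<alpha>\<close>, is symmetric, and the Jacobi
  sum of three basis vectors equals the left-hand side of (3) up to sign.\<close>

section \<open>Extending identities linearly from a spanning set\<close>

lemma (in module) vanish_on_span: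
  assumes add: "\<And>u v. u \<in> span B \<Longrightarrow> v \<in> span B \<Longrightarrow> f (u + v) = f u + f v"
    and hom: "\<And>c u. u \<in> span B \<Longrightarrow> f (scale c u) = s c (f u)"
    and s0: "\<And>c. s c 0 = (0 :: 'w::ab_group_add)"
    and base: "\<And>b. b \<in> B \<Longrightarrow> f b = 0"
    and "u \<in> span B"
  shows "f u = 0"
proof -
  \<comment> \<open>Membership is carried through the induction, since \<open>add\<close> and
    \<open>hom\<close> apply only inside the span.\<close>
  have "u \<in> span B \<and> f u = 0"
    using \<open>u \<in> span B\<close>
  proof (induction rule: span_induct_alt)
    case base
    have "f (0 + 0) = f 0 + f 0"
      by (rule add) (simp_all add: span_zero)
    then show ?case by (simp add: span_zero)
  next
    case (step c b v)
    then show ?case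
      by (simp add: add hom s0 base span_base span_scale span_add)
  qed
  then show ?thesis by simp
qed

section \<open>Functional equations for structure constants on \<Delta>\<close>

text \<open>Here \<open>p\<close>, \<open>q\<close>, \<open>r\<close> stand for
  \<open>\<phi> \<alpha> \<beta>\<close>, \<open>\<phi> \<beta> \<gamma>\<close>,
  \<open>\<phi> \<gamma> \<alpha>\<close> and \<open>S\<close> for the symmetric value; as free
  variables they turn the Jacobi computation into a polynomial identity.\<close>

lemma cyclic_bracket_identity:
  fixes \<alpha> \<beta> \<gamma> p q r S a :: complex
  shows "(q + a * (\<gamma> - \<beta>)) * (p - r - \<alpha> * S + a * (\<beta> + \<gamma> - \<alpha>)) +
    (r + a * (\<alpha> - \<gamma>)) * (q - p - \<beta> * S + a * (\<gamma> + \<alpha> - \<beta>)) +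
    (p + a * (\<beta> - \<alpha>)) * (r - q - \<gamma> * S + a * (\<alpha> + \<beta> - \<gamma>)) =
    - ((\<gamma> * p + \<alpha> * q + \<beta> * r) * (S - a))"
  by algebra

text \<open>With \<open>u = x \<alpha>\<close>, \<open>v = x \<beta>\<close>,
  \<open>w = x \<gamma>\<close>, this is the coefficient of
  \<open>x (\<alpha> + \<beta> + \<gamma> + \<theta>)\<close> in the compatibility condition;
  \<open>c\<close> is the component of the bracket that shifts degree by \<theta>.\<close>

definition compatibility_defect ::
    "(complex \<Rightarrow> complex \<Rightarrow> complex) \<Rightarrow> complex \<Rightarrow> complex \<Rightarrow> complex \<Rightarrow> complex \<Rightarrow> complex" where
  "compatibility_defect c \<theta> \<alpha> \<beta> \<gamma> = \<alpha> * c (\<alpha> + \<gamma>) \<beta> - \<beta> * c (\<beta> + \<gamma>) \<alpha> + \<beta> * c \<gamma> \<alpha>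
     - \<alpha> * c \<gamma> \<beta> - (\<alpha> + \<beta> + \<theta>) * c \<alpha> \<beta>"

text \<open>The coefficient of \<open>x (\<alpha> + \<beta> + \<gamma>)\<close> in the Jacobi sum of
  three basis vectors, for the graded bracket with structure constants \<open>c\<close>.\<close>

definition jacobi_defect ::
    "(complex \<Rightarrow> complex \<Rightarrow> complex) \<Rightarrow> complex \<Rightarrow> complex \<Rightarrow> complex \<Rightarrow> complex" where
  "jacobi_defect c \<alpha> \<beta> \<gamma> =
     c \<beta> \<gamma> * c \<alpha> (\<beta> + \<gamma>) + c \<gamma> \<alpha> * c \<beta> (\<gamma> + \<alpha>) + c \<alpha> \<beta> * c \<gamma> (\<alpha> + \<beta>)"

text \<open>An equality rather than a vanishing statement, so that it yields the Jacobi identity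
  from the product condition on \<open>S \<alpha> \<beta> \<gamma> - a\<close> and also the
  reverse.\<close>

lemma jacobi_defect_eq:
  assumes skew: "skew_symmetric_on \<Delta> \<phi>" and S: "symmetric3_on \<Delta> S"
    and \<Delta>: "additive_subgroup_of_complex \<Delta>"
    and defect: "\<And>\<alpha> \<beta> \<gamma>. \<alpha> \<in> \<Delta> \<Longrightarrow> \<beta> \<in> \<Delta> \<Longrightarrow> \<gamma> \<in> \<Delta> \<Longrightarrow>
      \<phi> (\<beta> + \<gamma>) \<alpha> = \<phi> \<gamma> \<alpha> + \<phi> \<beta> \<alpha> + \<alpha> * S \<alpha> \<beta> \<gamma>"
    and mem: "\<alpha> \<in> \<Delta>" "\<beta> \<in> \<Delta>" "\<gamma> \<in> \<Delta>"
  shows "jacobi_defect (\<lambda>\<alpha> \<beta>. \<phi> \<alpha> \<beta> + a * (\<beta> - \<alpha>)) \<alpha> \<beta> \<gamma> =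
    - ((\<gamma> * \<phi> \<alpha> \<beta> + \<alpha> * \<phi> \<beta> \<gamma> + \<beta> * \<phi> \<gamma> \<alpha>) * (S \<alpha> \<beta> \<gamma> - a))"
proof -
  \<comment> \<open>Skew-symmetry moves the defect relation to the second argument, where the nested
    brackets need it.\<close>
  have sum: "\<phi> \<kappa> (\<mu> + \<nu>) = \<phi> \<kappa> \<mu> - \<phi> \<nu> \<kappa> - \<kappa> * S \<kappa> \<mu> \<nu>"
    if "\<kappa> \<in> \<Delta>" "\<mu> \<in> \<Delta>" "\<nu> \<in> \<Delta>" for \<kappa> \<mu> \<nu>
  proof -
    have "\<mu> + \<nu> \<in> \<Delta>" using that \<Delta> by (auto simp: additive_subgroup_of_complex_def)
    then have "\<phi> \<kappa> (\<mu> + \<nu>) = - \<phi> (\<mu> + \<nu>) \<kappa>" "\<phi> \<kappa> \<mu> = - \<phi> \<mu> \<kappa>"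
      using skew that unfolding skew_symmetric_on_def by blast+
    then show ?thesis using defect[OF that] by simp
  qed
  have "S \<beta> \<gamma> \<alpha> = S \<alpha> \<beta> \<gamma>" "S \<gamma> \<alpha> \<beta> = S \<alpha> \<beta> \<gamma>"
    using S mem unfolding symmetric3_on_def by metis+
  then show ?thesis
    unfolding jacobi_defect_def cyclic_bracket_identity[symmetric]
    by (simp add: sum mem)
qed

lemma admissible_defects:
  assumes "admissible \<Delta> a \<phi>" and \<Delta>: "additive_subgroup_of_complex \<Delta>"
    and mem: "\<alpha> \<in> \<Delta>" "\<beta> \<in> \<Delta>" "\<gamma> \<in> \<Delta>"
  shows "compatibility_defect (\<lambda>\<alpha> \<beta>. \<phi> \<alpha> \<beta> + a * (\<beta> - \<alpha>)) 0 \<alpha> \<beta> \<gamma> = 0"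
    and "jacobi_defect (\<lambda>\<alpha> \<beta>. \<phi> \<alpha> \<beta> + a * (\<beta> - \<alpha>)) \<alpha> \<beta> \<gamma> = 0"
proof -
  obtain S where skew: "skew_symmetric_on \<Delta> \<phi>" and S: "symmetric3_on \<Delta> S"
    and eqs: "\<And>\<alpha> \<beta> \<gamma>. \<alpha> \<in> \<Delta> \<Longrightarrow> \<beta> \<in> \<Delta> \<Longrightarrow> \<gamma> \<in> \<Delta> \<Longrightarrow>
        \<phi> (\<beta> + \<gamma>) \<alpha> = \<phi> \<gamma> \<alpha> + \<phi> \<beta> \<alpha> + \<alpha> * S \<alpha> \<beta> \<gamma> \<and>
        (\<gamma> * \<phi> \<alpha> \<beta> + \<alpha> * \<phi> \<beta> \<gamma> + \<beta> * \<phi> \<gamma> \<alpha>) * (S \<alpha> \<beta> \<gamma> - a) = 0"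
    using assms(1) unfolding admissible_def by blast
  have "jacobi_defect (\<lambda>\<alpha> \<beta>. \<phi> \<alpha> \<beta> + a * (\<beta> - \<alpha>)) \<alpha> \<beta> \<gamma> =
      - ((\<gamma> * \<phi> \<alpha> \<beta> + \<alpha> * \<phi> \<beta> \<gamma> + \<beta> * \<phi> \<gamma> \<alpha>) * (S \<alpha> \<beta> \<gamma> - a))"
    by (rule jacobi_defect_eq[OF skew S \<Delta> _ mem]) (use eqs in blast)
  then show "jacobi_defect (\<lambda>\<alpha> \<beta>. \<phi> \<alpha> \<beta> + a * (\<beta> - \<alpha>)) \<alpha> \<beta> \<gamma> = 0"
    using eqs[OF mem] by (simp only: minus_zero)
  \<comment> \<open>By symmetry both relations involve the same
    \<open>S \<alpha> \<beta> \<gamma>\<close>; in the compatibility defect it occurs with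
    coefficients \<alpha>\<beta> and -\<beta>\<alpha> and cancels.\<close>
  have "\<phi> (\<beta> + \<gamma>) \<alpha> = \<phi> \<gamma> \<alpha> + \<phi> \<beta> \<alpha> + \<alpha> * S \<alpha> \<beta> \<gamma>"
    and "\<phi> (\<alpha> + \<gamma>) \<beta> = \<phi> \<gamma> \<beta> + \<phi> \<alpha> \<beta> + \<beta> * S \<alpha> \<beta> \<gamma>"
    and "\<phi> \<beta> \<alpha> = - \<phi> \<alpha> \<beta>"
    using eqs mem skew S unfolding symmetric3_on_def skew_symmetric_on_def by metis+
  then show "compatibility_defect (\<lambda>\<alpha> \<beta>. \<phi> \<alpha> \<beta> + a * (\<beta> - \<alpha>)) 0 \<alpha> \<beta> \<gamma> = 0"
    unfolding compatibility_defect_def by algebra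
qed

lemma compatibility_imp_vanishing:
  assumes skew: "skew_symmetric_on \<Delta> c" and "0 \<in> \<Delta>" and "\<theta> \<noteq> 0"
    and E: "\<And>\<alpha> \<beta>. \<alpha> \<in> \<Delta> \<Longrightarrow> \<beta> \<in> \<Delta> \<Longrightarrow> compatibility_defect c \<theta> \<alpha> \<beta> 0 = 0"
    and mem: "\<alpha> \<in> \<Delta>" "\<beta> \<in> \<Delta>"
  shows "c \<alpha> \<beta> = 0"
proof -
  have key: "\<theta> * c \<kappa> \<mu> = \<mu> * c 0 \<kappa> - \<kappa> * c 0 \<mu>" if "\<kappa> \<in> \<Delta>" "\<mu> \<in> \<Delta>" for \<kappa> \<mu>
  proof -
    have "c \<mu> \<kappa> = - c \<kappa> \<mu>" using skew that unfolding skew_symmetric_on_def by blast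
    then show ?thesis using E[OF that] by (simp add: compatibility_defect_def algebra_simps)
  qed
  \<comment> \<open>Two specialisations of \<open>key\<close>: first both arguments 0, then only the
    first. They kill the row \<open>c 0\<close>, hence the whole right-hand side of
    \<open>key\<close>.\<close>
  have "c 0 0 = 0" using key[of 0 0] \<open>0 \<in> \<Delta>\<close> \<open>\<theta> \<noteq> 0\<close> by simp
  then have "c 0 \<kappa> = 0" if "\<kappa> \<in> \<Delta>" for \<kappa>
    using key[of 0 \<kappa>] \<open>0 \<in> \<Delta>\<close> \<open>\<theta> \<noteq> 0\<close> that by simp
  then show ?thesis using key mem \<open>\<theta> \<noteq> 0\<close> by simp
qed

lemma defects_imp_admissible:
  assumes skew: "skew_symmetric_on \<Delta> c" and \<Delta>: "additive_subgroup_of_complex \<Delta>"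
    and E: "\<And>\<alpha> \<beta> \<gamma>. \<alpha> \<in> \<Delta> \<Longrightarrow> \<beta> \<in> \<Delta> \<Longrightarrow> \<gamma> \<in> \<Delta> \<Longrightarrow> compatibility_defect c 0 \<alpha> \<beta> \<gamma> = 0"
    and J: "\<And>\<alpha> \<beta> \<gamma>. \<alpha> \<in> \<Delta> \<Longrightarrow> \<beta> \<in> \<Delta> \<Longrightarrow> \<gamma> \<in> \<Delta> \<Longrightarrow> jacobi_defect c \<alpha> \<beta> \<gamma> = 0"
  shows "\<exists>a. admissible \<Delta> a (\<lambda>\<alpha> \<beta>. c \<alpha> \<beta> - a * (\<beta> - \<alpha>))"
proof -
  have zero: "0 \<in> \<Delta>" and plus: "\<And>\<alpha> \<beta>. \<alpha> \<in> \<Delta> \<Longrightarrow> \<beta> \<in> \<Delta> \<Longrightarrow> \<alpha> + \<beta> \<in> \<Delta>"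
    using \<Delta> by (auto simp: additive_subgroup_of_complex_def)
  have sk: "c \<beta> \<alpha> = - c \<alpha> \<beta>" if "\<alpha> \<in> \<Delta>" "\<beta> \<in> \<Delta>" for \<alpha> \<beta>
    using skew that unfolding skew_symmetric_on_def by blast
  have c00: "c 0 0 = 0" using sk[OF zero zero] by simp
  \<comment> \<open>At \<gamma> = 0 the defect equation reads \<beta> c(0, \<alpha>) = \<alpha> c(0,
    \<beta>), so the ratio c(0, \<alpha>) / \<alpha> is the same for all nonzero \<alpha>. For
    trivial \<Delta> the choice 0 serves.\<close>
  obtain a where a: "\<And>\<beta>. \<beta> \<in> \<Delta> \<Longrightarrow> c 0 \<beta> = a * \<beta>"
  proof (cases "\<exists>\<alpha>\<in>\<Delta>. \<alpha> \<noteq> 0")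
    case True
    then obtain \<alpha> where \<alpha>: "\<alpha> \<in> \<Delta>" "\<alpha> \<noteq> 0" by blast
    have "c 0 \<beta> = (c 0 \<alpha> / \<alpha>) * \<beta>" if "\<beta> \<in> \<Delta>" for \<beta>
      using E[OF \<alpha>(1) that zero] sk[OF \<alpha>(1) that] \<alpha>(2)
      by (simp add: compatibility_defect_def field_simps)
    then show ?thesis by (rule that)
  next
    case False
    then have "c 0 \<beta> = 0 * \<beta>" if "\<beta> \<in> \<Delta>" for \<beta> using that c00 by auto
    then show ?thesis by (rule that)
  qed
  define \<phi> where "\<phi> = (\<lambda>\<alpha> \<beta>. c \<alpha> \<beta> - a * (\<beta> - \<alpha>))"
  have c: "c = (\<lambda>\<alpha> \<beta>. \<phi> \<alpha> \<beta> + a * (\<beta> - \<alpha>))" by (simp add: \<phi>_def)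
  have skew_\<phi>: "skew_symmetric_on \<Delta> \<phi>"
    unfolding skew_symmetric_on_def
  proof (intro ballI)
    fix \<alpha> \<beta> assume "\<alpha> \<in> \<Delta>" "\<beta> \<in> \<Delta>"
    then show "\<phi> \<alpha> \<beta> = - \<phi> \<beta> \<alpha>"
      using sk[of \<alpha> \<beta>] by (simp add: \<phi>_def algebra_simps)
  qed
  have sk\<phi>: "\<phi> \<beta> \<alpha> = - \<phi> \<alpha> \<beta>" if "\<alpha> \<in> \<Delta>" "\<beta> \<in> \<Delta>" for \<alpha> \<beta>
    using skew_\<phi> that unfolding skew_symmetric_on_def by blast
  \<comment> \<open>Subtracting \<open>a * (\<beta> - \<alpha>)\<close> was chosen to make \<phi>
    vanish when either argument is 0; this makes the defect \<open>F\<close> divisible at \<alpha> =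
    0.\<close>
  have \<phi>0: "\<phi> 0 \<beta> = 0" "\<phi> \<beta> 0 = 0" if "\<beta> \<in> \<Delta>" for \<beta>
    using sk\<phi>[OF zero that] that by (simp_all add: \<phi>_def a)
  define F where "F = (\<lambda>\<alpha> \<beta> \<gamma>. \<phi> (\<beta> + \<gamma>) \<alpha> - \<phi> \<gamma> \<alpha> - \<phi> \<beta> \<alpha>)"
  \<comment> \<open>Division by zero gives the value \<open>0\<close> for \<open>\<alpha> = 0\<close>, which is the one forced by symmetry when
    \<open>\<beta>\<close> or \<open>\<gamma>\<close> is nonzero.\<close>
  define S where "S = (\<lambda>\<alpha> \<beta> \<gamma>. F \<alpha> \<beta> \<gamma> / \<alpha>)"
  have F0: "F 0 \<beta> \<gamma> = 0" "F \<beta> 0 \<gamma> = 0" if "\<beta> \<in> \<Delta>" "\<gamma> \<in> \<Delta>" for \<beta> \<gamma>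
    using that by (simp_all add: F_def \<phi>0 plus)
  have F_swap: "\<alpha> * F \<beta> \<alpha> \<gamma> = \<beta> * F \<alpha> \<beta> \<gamma>" if "\<alpha> \<in> \<Delta>" "\<beta> \<in> \<Delta>" "\<gamma> \<in> \<Delta>" for \<alpha> \<beta> \<gamma>
    using E[OF that] sk\<phi>[OF that(1,2)] unfolding compatibility_defect_def c F_def by algebra
  \<comment> \<open>For nonzero \<alpha>, \<beta> divide \<open>F_swap\<close> by \<alpha>\<beta>.
    If one of them is 0, both sides are 0, one by \<open>F0\<close> and the other by division by
    zero.\<close>
  have S_swap: "S \<beta> \<alpha> \<gamma> = S \<alpha> \<beta> \<gamma>" if "\<alpha> \<in> \<Delta>" "\<beta> \<in> \<Delta>" "\<gamma> \<in> \<Delta>" for \<alpha> \<beta> \<gamma>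
    using F_swap[OF that] F0 that
    by (cases "\<alpha> = 0"; cases "\<beta> = 0") (auto simp: S_def field_simps)
  have S_swap': "S \<alpha> \<gamma> \<beta> = S \<alpha> \<beta> \<gamma>" for \<alpha> \<beta> \<gamma>
    by (simp add: S_def F_def add.commute)
  \<comment> \<open>Two adjacent transpositions generate all permutations of three
    arguments.\<close>
  have S_sym: "symmetric3_on \<Delta> S"
    unfolding symmetric3_on_def by (metis S_swap S_swap')
  have defect: "\<phi> (\<beta> + \<gamma>) \<alpha> = \<phi> \<gamma> \<alpha> + \<phi> \<beta> \<alpha> + \<alpha> * S \<alpha> \<beta> \<gamma>"
    if "\<alpha> \<in> \<Delta>" "\<beta> \<in> \<Delta>" "\<gamma> \<in> \<Delta>" for \<alpha> \<beta> \<gamma>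
  proof -
    have "F \<alpha> \<beta> \<gamma> = \<alpha> * S \<alpha> \<beta> \<gamma>"
      using F0(1)[OF that(2,3)] by (cases "\<alpha> = 0") (simp_all add: S_def)
    then show ?thesis unfolding F_def by algebra
  qed
  have "(\<gamma> * \<phi> \<alpha> \<beta> + \<alpha> * \<phi> \<beta> \<gamma> + \<beta> * \<phi> \<gamma> \<alpha>) * (S \<alpha> \<beta> \<gamma> - a) = 0"
    if "\<alpha> \<in> \<Delta>" "\<beta> \<in> \<Delta>" "\<gamma> \<in> \<Delta>" for \<alpha> \<beta> \<gamma>
    using jacobi_defect_eq[OF skew_\<phi> S_sym \<Delta> defect that, of a] J[OF that]
    unfolding c by (metis neg_equal_0_iff_equal)
  then have "admissible \<Delta> a \<phi>"
    unfolding admissible_def using skew_\<phi> S_sym defect by blast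
  then show ?thesis unfolding \<phi>_def by blast
qed

section \<open>The two families of examples\<close>

text \<open>The witness \<open>S = 0\<close> expresses additivity, and the factor
  \<open>S - a\<close> is then 0.\<close>

lemma admissible_bilinear:
  assumes "skew_symmetric_on \<Delta> \<phi>" "Z_bilinear_on \<Delta> \<phi>"
  shows "admissible \<Delta> 0 \<phi>"
  unfolding admissible_def
proof (intro conjI exI[of _ "\<lambda>_ _ _. 0"])
qed (use assms in \<open>auto simp: symmetric3_on_def Z_bilinear_on_def additive_map_on_def\<close>)

text \<open>Again \<open>S = 0\<close> because the form is biadditive; now the cyclic sum vanishes
  by cancellation, which settles the product condition for any \<open>a\<close>.\<close>

lemma admissible_additive:
  assumes "additive_map_on \<Delta> f"
  shows "admissible \<Delta> a (\<lambda>\<alpha> \<beta>. \<alpha> * f \<beta> - \<beta> * f \<alpha>)"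
  unfolding admissible_def
proof (intro conjI exI[of _ "\<lambda>_ _ _. 0"])
qed (use assms in \<open>auto simp: symmetric3_on_def skew_symmetric_on_def additive_map_on_def
  algebra_simps\<close>)

section \<open>Linear algebra on the carrier subspace\<close>

context complex_algebra
begin

lemma carrier_closed [simp]:
  "u \<in> A \<Longrightarrow> v \<in> A \<Longrightarrow> u + v \<in> A"
  "u \<in> A \<Longrightarrow> v \<in> A \<Longrightarrow> u - v \<in> A"
  "u \<in> A \<Longrightarrow> scale c u \<in> A"
  "u \<in> A \<Longrightarrow> v \<in> A \<Longrightarrow> mul u v \<in> A"
  using subspace_carrier
  by (auto intro: subspace_add subspace_diff subspace_scale mul_closed)

lemma mul_diff_left: "u \<in> A \<Longrightarrow> v \<in> A \<Longrightarrow> w \<in> A \<Longrightarrow> mul (u - v) w = mul u w - mul v w"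
  using mul_add_left[of "u - v" v w] by (simp add: algebra_simps)

lemma mul_diff_right: "u \<in> A \<Longrightarrow> v \<in> A \<Longrightarrow> w \<in> A \<Longrightarrow> mul u (v - w) = mul u v - mul u w"
  using mul_add_right[of u "v - w" w] by (simp add: algebra_simps)

lemmas mul_linear = mul_add_left mul_add_right mul_scale_left mul_scale_right
  mul_diff_left mul_diff_right

text \<open>Pass from basis vectors to all of \<open>A\<close> one slot at a time: third, second,
  first.\<close>

lemma trilinear_vanish:
  assumes A: "span B = A"
    and 1: "\<And>u u' v w. u \<in> A \<Longrightarrow> u' \<in> A \<Longrightarrow> v \<in> A \<Longrightarrow> w \<in> A \<Longrightarrow> f (u + u') v w = f u v w + f u' v w"
      "\<And>c u v w. u \<in> A \<Longrightarrow> v \<in> A \<Longrightarrow> w \<in> A \<Longrightarrow> f (scale c u) v w = scale c (f u v w)"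
    and 2: "\<And>u v v' w. u \<in> A \<Longrightarrow> v \<in> A \<Longrightarrow> v' \<in> A \<Longrightarrow> w \<in> A \<Longrightarrow> f u (v + v') w = f u v w + f u v' w"
      "\<And>c u v w. u \<in> A \<Longrightarrow> v \<in> A \<Longrightarrow> w \<in> A \<Longrightarrow> f u (scale c v) w = scale c (f u v w)"
    and 3: "\<And>u v w w'. u \<in> A \<Longrightarrow> v \<in> A \<Longrightarrow> w \<in> A \<Longrightarrow> w' \<in> A \<Longrightarrow> f u v (w + w') = f u v w + f u v w'"
      "\<And>c u v w. u \<in> A \<Longrightarrow> v \<in> A \<Longrightarrow> w \<in> A \<Longrightarrow> f u v (scale c w) = scale c (f u v w)"
    and base: "\<And>b b' b''. b \<in> B \<Longrightarrow> b' \<in> B \<Longrightarrow> b'' \<in> B \<Longrightarrow> f b b' b'' = 0"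
    and mem: "u \<in> A" "v \<in> A" "w \<in> A"
  shows "f u v w = 0"
proof -
  have BA: "\<And>b. b \<in> B \<Longrightarrow> b \<in> A" using A span_base by blast
  have w: "f b b' w = 0" if "b \<in> B" "b' \<in> B" "w \<in> A" for b b' w
    by (rule vanish_on_span[of B "\<lambda>w. f b b' w" scale]) (use that A BA 3 base in auto)
  have v: "f b v w = 0" if "b \<in> B" "v \<in> A" "w \<in> A" for b v w
    by (rule vanish_on_span[of B "\<lambda>v. f b v w" scale]) (use that A BA 2 w in auto)
  show ?thesis
    by (rule vanish_on_span[of B "\<lambda>u. f u v w" scale]) (use mem A 1 v in auto)
qed

end

section \<open>Coordinates and the Novikov product\<close>

context novikov_Delta
begin

lemma Delta_closed [simp]:
  "0 \<in> \<Delta>" "\<alpha> \<in> \<Delta> \<Longrightarrow> \<beta> \<in> \<Delta> \<Longrightarrow> \<alpha> + \<beta> \<in> \<Delta>"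
  "\<alpha> \<in> \<Delta> \<Longrightarrow> \<beta> \<in> \<Delta> \<Longrightarrow> \<alpha> - \<beta> \<in> \<Delta>"
  using subgroup_Delta unfolding additive_subgroup_of_complex_def
  by (auto simp: diff_conv_add_uminus simp del: add_uminus_conv_diff)

lemma basis_in_carrier [simp]: "\<alpha> \<in> \<Delta> \<Longrightarrow> x \<alpha> \<in> A"
  using span_base span_basis by blast

text \<open>Coordinates are indexed by \<Delta> rather than by basis vectors, so that multiplying by
  a basis vector becomes an index shift.\<close>

definition coeff :: "complex \<Rightarrow> 'v \<Rightarrow> complex" where
  "coeff \<delta> v = representation (x ` \<Delta>) v (x \<delta>)"

lemma coeff_linear [simp]:
  "u \<in> A \<Longrightarrow> v \<in> A \<Longrightarrow> coeff \<delta> (u + v) = coeff \<delta> u + coeff \<delta> v"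
  "u \<in> A \<Longrightarrow> v \<in> A \<Longrightarrow> coeff \<delta> (u - v) = coeff \<delta> u - coeff \<delta> v"
  "u \<in> A \<Longrightarrow> coeff \<delta> (scale c u) = c * coeff \<delta> u"
  "coeff \<delta> 0 = 0"
  using independent_basis span_basis
  by (simp_all add: coeff_def representation_add representation_diff representation_scale
      representation_zero)

lemma coeff_basis: "\<alpha> \<in> \<Delta> \<Longrightarrow> \<delta> \<in> \<Delta> \<Longrightarrow> coeff \<delta> (x \<alpha>) = (if \<delta> = \<alpha> then 1 else 0)"
  using independent_basis inj_basis
  by (auto simp: coeff_def representation_basis inj_on_eq_iff)

lemma coeff_eqI:
  assumes "u \<in> A" "v \<in> A" and eq: "\<And>\<delta>. \<delta> \<in> \<Delta> \<Longrightarrow> coeff \<delta> u = coeff \<delta> v"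
  shows "u = v"
proof -
  \<comment> \<open>\<open>representation\<close> vanishes off the basis, so agreement at the
    vectors \<open>x \<delta>\<close> suffices.\<close>
  have "representation (x ` \<Delta>) u = representation (x ` \<Delta>) v"
  proof
    fix b
    show "representation (x ` \<Delta>) u b = representation (x ` \<Delta>) v b"
      using eq representation_ne_zero[of "x ` \<Delta>" _ b] unfolding coeff_def by (metis imageE)
  qed
  then show ?thesis
    using sum_nonzero_representation_eq[OF independent_basis] assms(1,2) span_basis by metis
qed

lemma coeff_circ_right:
  assumes \<beta>: "\<beta> \<in> \<Delta>" and \<delta>: "\<delta> \<in> \<Delta>" and "y \<in> A"
  shows "coeff \<delta> (circ y (x \<beta>)) = \<beta> * coeff (\<delta> - \<beta>) y"
proof -
  have "coeff \<delta> (circ y (x \<beta>)) - \<beta> * coeff (\<delta> - \<beta>) y = 0"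
    by (rule vanish_on_span[where B = "x ` \<Delta>" and s = "(*)"])
      (use assms in \<open>auto simp: span_basis mul_linear circ_basis coeff_basis algebra_simps\<close>)
  then show ?thesis by simp
qed

text \<open>Unlike right multiplication by \<open>x \<beta>\<close>, which scales by the constant
  \<beta>, left multiplication scales each component by its own index. This is the source of the
  factor \<alpha> + \<beta> + \<theta> in \<open>compatibility_defect\<close>.\<close>

lemma coeff_circ_left:
  assumes \<gamma>: "\<gamma> \<in> \<Delta>" and \<delta>: "\<delta> \<in> \<Delta>" and "y \<in> A"
  shows "coeff \<delta> (circ (x \<gamma>) y) = (\<delta> - \<gamma>) * coeff (\<delta> - \<gamma>) y"
proof -
  have "coeff \<delta> (circ (x \<gamma>) y) - (\<delta> - \<gamma>) * coeff (\<delta> - \<gamma>) y = 0"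
    by (rule vanish_on_span[where B = "x ` \<Delta>" and s = "(*)"])
      (use assms in \<open>auto simp: span_basis mul_linear circ_basis coeff_basis algebra_simps\<close>)
  then show ?thesis by simp
qed

text \<open>On basis vectors (u v) w has coefficient \<beta>\<gamma>, symmetric in \<beta> and
  \<gamma>, and the associator has coefficient -\<gamma>\<gamma>, independent of \<alpha> and
  \<beta>.\<close>

lemma novikov: "novikov_algebra scale A circ"
proof
  fix u v w assume mem: "u \<in> A" "v \<in> A" "w \<in> A"
  have "circ (circ u v) w - circ (circ u w) v = 0"
    by (rule trilinear_vanish[OF span_basis,
          where f = "\<lambda>u v w. circ (circ u v) w - circ (circ u w) v"])
      (use mem in \<open>auto simp: mul_linear circ_basis algebra_simps\<close>)
  then show "circ (circ u v) w = circ (circ u w) v" by simp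
  have "associator circ u v w - associator circ v u w = 0"
    by (rule trilinear_vanish[OF span_basis,
          where f = "\<lambda>u v w. associator circ u v w - associator circ v u w"])
      (use mem in \<open>auto simp: associator_def mul_linear circ_basis algebra_simps\<close>)
  then show "associator circ u v w = associator circ v u w" by simp
qed

section \<open>Classification of the brackets\<close>

lemma bracket_form_if_bialgebra:
  assumes "gelfand_dorfman_bialgebra scale A br circ"
  shows "\<exists>a \<phi>. admissible \<Delta> a \<phi> \<and> has_bracket_form scale \<Delta> x a \<phi> br"
proof -
  interpret gd: gelfand_dorfman_bialgebra scale A br circ by fact
  \<comment> \<open>Polarisation of the alternating law.\<close>
  have br_skew: "br v u = - br u v" if "u \<in> A" "v \<in> A" for u v
    using gd.lie.alternating[of "u + v"] gd.lie.alternating[of u] gd.lie.alternating[of v] that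
    by (simp add: gd.lie.mul_linear eq_neg_iff_add_eq_0 add.commute)
  define c where "c = (\<lambda>\<theta> \<alpha> \<beta>. coeff (\<alpha> + \<beta> + \<theta>) (br (x \<alpha>) (x \<beta>)))"
  have br_in: "br (x \<alpha>) (x \<beta>) \<in> A" if "\<alpha> \<in> \<Delta>" "\<beta> \<in> \<Delta>" for \<alpha> \<beta>
    using that by simp
  have skew: "skew_symmetric_on \<Delta> (c \<theta>)" for \<theta>
    unfolding skew_symmetric_on_def
  proof (intro ballI)
    fix \<alpha> \<beta> assume mem: "\<alpha> \<in> \<Delta>" "\<beta> \<in> \<Delta>"
    \<comment> \<open>The sign is written as a scalar because \<open>coeff_linear\<close> treats
      scalars but not negation.\<close>
    have "br (x \<alpha>) (x \<beta>) = scale (-1) (br (x \<beta>) (x \<alpha>))"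
      using br_skew[of "x \<beta>" "x \<alpha>"] mem by simp
    then show "c \<theta> \<alpha> \<beta> = - c \<theta> \<beta> \<alpha>"
      using mem br_in by (simp add: c_def add.commute del: scale_minus_left)
  qed
  have E: "compatibility_defect (c \<theta>) \<theta> \<alpha> \<beta> \<gamma> = 0"
    if mem: "\<alpha> \<in> \<Delta>" "\<beta> \<in> \<Delta>" "\<gamma> \<in> \<Delta>" "\<theta> \<in> \<Delta>" for \<theta> \<alpha> \<beta> \<gamma>
  proof -
    have "coeff (\<alpha> + \<beta> + \<gamma> + \<theta>) (br (circ (x \<gamma>) (x \<alpha>)) (x \<beta>) - br (circ (x \<gamma>) (x \<beta>)) (x \<alpha>)
      + circ (br (x \<gamma>) (x \<alpha>)) (x \<beta>) - circ (br (x \<gamma>) (x \<beta>)) (x \<alpha>)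
      - circ (x \<gamma>) (br (x \<alpha>) (x \<beta>))) = 0"
      using gd.compatible[of "x \<alpha>" "x \<beta>" "x \<gamma>"] mem by simp
    then show ?thesis
      using mem
      by (simp add: circ_basis gd.lie.mul_scale_left coeff_circ_left coeff_circ_right
          compatibility_defect_def c_def algebra_simps)
  qed
  have br_basis: "br (x \<alpha>) (x \<beta>) = scale (c 0 \<alpha> \<beta>) (x (\<alpha> + \<beta>))"
    if mem: "\<alpha> \<in> \<Delta>" "\<beta> \<in> \<Delta>" for \<alpha> \<beta>
  proof (rule coeff_eqI)
    fix \<delta> assume "\<delta> \<in> \<Delta>"
    show "coeff \<delta> (br (x \<alpha>) (x \<beta>)) = coeff \<delta> (scale (c 0 \<alpha> \<beta>) (x (\<alpha> + \<beta>)))"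
    proof (cases "\<delta> = \<alpha> + \<beta>")
      case True
      then show ?thesis using mem by (simp add: coeff_basis c_def)
    next
      case False
      \<comment> \<open>The shift \<theta> = \<delta> - \<alpha> - \<beta> is a nonzero element of
        \<Delta>, so this component of the bracket vanishes.\<close>
      then have "c (\<delta> - \<alpha> - \<beta>) \<alpha> \<beta> = 0"
        using mem \<open>\<delta> \<in> \<Delta>\<close>
        by (intro compatibility_imp_vanishing[OF skew, where \<theta> = "\<delta> - \<alpha> - \<beta>"] E)
          (auto simp: algebra_simps)
      then show ?thesis
        using False mem \<open>\<delta> \<in> \<Delta>\<close> by (simp add: coeff_basis c_def)
    qed
  qed (use mem in auto)
  have J: "jacobi_defect (c 0) \<alpha> \<beta> \<gamma> = 0"
    if mem: "\<alpha> \<in> \<Delta>" "\<beta> \<in> \<Delta>" "\<gamma> \<in> \<Delta>" for \<alpha> \<beta> \<gamma>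
  proof -
    have "coeff (\<alpha> + \<beta> + \<gamma>) (br (x \<alpha>) (br (x \<beta>) (x \<gamma>)) + br (x \<beta>) (br (x \<gamma>) (x \<alpha>))
      + br (x \<gamma>) (br (x \<alpha>) (x \<beta>))) = 0"
      using gd.lie.jacobi[of "x \<alpha>" "x \<beta>" "x \<gamma>"] mem by simp
    then show ?thesis
      using mem
      by (simp add: br_basis gd.lie.mul_scale_right coeff_basis jacobi_defect_def
          add.commute add.left_commute)
  qed
  obtain a where "admissible \<Delta> a (\<lambda>\<alpha> \<beta>. c 0 \<alpha> \<beta> - a * (\<beta> - \<alpha>))"
    using defects_imp_admissible[OF skew subgroup_Delta, of 0] E J by auto
  moreover have "has_bracket_form scale \<Delta> x a (\<lambda>\<alpha> \<beta>. c 0 \<alpha> \<beta> - a * (\<beta> - \<alpha>)) br"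
    by (simp add: has_bracket_form_def br_basis)
  ultimately show ?thesis by blast
qed

section \<open>The converse: laws checked on the basis\<close>

lemma bialgebra_if_bracket_form:
  assumes adm: "admissible \<Delta> a \<phi>" and "complex_algebra scale A br"
    and form: "has_bracket_form scale \<Delta> x a \<phi> br"
  shows "gelfand_dorfman_bialgebra scale A br circ"
proof -
  interpret br: complex_algebra scale A br by fact
  interpret nov: novikov_algebra scale A circ by (rule novikov)
  define c where "c = (\<lambda>\<alpha> \<beta>. \<phi> \<alpha> \<beta> + a * (\<beta> - \<alpha>))"
  have br_basis: "br (x \<alpha>) (x \<beta>) = scale (c \<alpha> \<beta>) (x (\<alpha> + \<beta>))" if "\<alpha> \<in> \<Delta>" "\<beta> \<in> \<Delta>" for \<alpha> \<beta>
    using form that by (simp add: has_bracket_form_def c_def)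
  have c_skew: "c \<beta> \<alpha> = - c \<alpha> \<beta>" if "\<alpha> \<in> \<Delta>" "\<beta> \<in> \<Delta>" for \<alpha> \<beta>
  proof -
    have "\<phi> \<beta> \<alpha> = - \<phi> \<alpha> \<beta>"
      using adm that unfolding admissible_def skew_symmetric_on_def by blast
    then show ?thesis by (simp add: c_def algebra_simps)
  qed
  note defects = admissible_defects[OF adm subgroup_Delta, folded c_def]
  have br_skew: "br u v + br v u = 0" if "u \<in> A" "v \<in> A" for u v
  proof -
    have "br (x \<alpha>) (x \<beta>) + br (x \<beta>) (x \<alpha>) = 0" if "\<alpha> \<in> \<Delta>" "\<beta> \<in> \<Delta>" for \<alpha> \<beta>
      using that c_skew[OF that] by (simp add: br_basis add.commute)
    \<comment> \<open>Skew-symmetry is extended first in \<open>w\<close>, then in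
      \<open>u\<close>.\<close>
    then have "br (x \<alpha>) w + br w (x \<alpha>) = 0" if "\<alpha> \<in> \<Delta>" "w \<in> A" for \<alpha> w
      by (intro vanish_on_span[where B = "x ` \<Delta>" and s = scale and u = w
            and f = "\<lambda>w. br (x \<alpha>) w + br w (x \<alpha>)"])
        (use that in \<open>auto simp: span_basis br.mul_linear algebra_simps\<close>)
    then show ?thesis
      by (intro vanish_on_span[where B = "x ` \<Delta>" and s = scale and u = u
            and f = "\<lambda>u. br u v + br v u"])
        (use that in \<open>auto simp: span_basis br.mul_linear algebra_simps\<close>)
  qed
  show ?thesis
  proof
    fix u assume "u \<in> A"
    then have "scale 2 (br u u) = 0"
      using br_skew[of u u] scale_left_distrib[of 1 1 "br u u"] by simp
    then show "br u u = 0" by simp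
  next
    fix u v w assume mem: "u \<in> A" "v \<in> A" "w \<in> A"
    have jac: "br (x \<alpha>) (br (x \<beta>) (x \<gamma>)) + br (x \<beta>) (br (x \<gamma>) (x \<alpha>))
        + br (x \<gamma>) (br (x \<alpha>) (x \<beta>)) = 0" if "\<alpha> \<in> \<Delta>" "\<beta> \<in> \<Delta>" "\<gamma> \<in> \<Delta>" for \<alpha> \<beta> \<gamma>
    proof -
      \<comment> \<open>The three index sums get one normal form, so that the scalars can be
        collected in front of a single basis vector.\<close>
      have perm: "\<beta> + (\<gamma> + \<alpha>) = \<alpha> + (\<beta> + \<gamma>)" "\<gamma> + (\<alpha> + \<beta>) = \<alpha> + (\<beta> + \<gamma>)" by simp_all
      then show ?thesis
        using that defects(2)[OF that]
        by (simp add: br_basis br.mul_scale_right perm scale_left_distrib[symmetric] jacobi_defect_def)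
    qed
    show "br u (br v w) + br v (br w u) + br w (br u v) = 0"
    proof (rule trilinear_vanish[OF span_basis,
          where f = "\<lambda>u v w. br u (br v w) + br v (br w u) + br w (br u v)"])
      fix b b' b'' assume "b \<in> x ` \<Delta>" "b' \<in> x ` \<Delta>" "b'' \<in> x ` \<Delta>"
      then show "br b (br b' b'') + br b' (br b'' b) + br b'' (br b b') = 0"
        by (elim imageE) (simp only: jac)
    qed (use mem in \<open>simp_all add: br.mul_linear algebra_simps\<close>)
    have comp: "br (circ (x \<gamma>) (x \<alpha>)) (x \<beta>) - br (circ (x \<gamma>) (x \<beta>)) (x \<alpha>)
        + circ (br (x \<gamma>) (x \<alpha>)) (x \<beta>) - circ (br (x \<gamma>) (x \<beta>)) (x \<alpha>)
        - circ (x \<gamma>) (br (x \<alpha>) (x \<beta>)) = 0" (is "?e = 0")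
      if "\<alpha> \<in> \<Delta>" "\<beta> \<in> \<Delta>" "\<gamma> \<in> \<Delta>" for \<alpha> \<beta> \<gamma>
    proof -
      have "?e = scale (compatibility_defect c 0 \<alpha> \<beta> \<gamma>) (x (\<alpha> + \<beta> + \<gamma>))"
        using that
        by (simp add: br_basis circ_basis br.mul_scale_left mul_scale_left mul_scale_right
            compatibility_defect_def algebra_simps)
      then show ?thesis using defects(1)[OF that] by simp
    qed
    show "br (circ w u) v - br (circ w v) u + circ (br w u) v - circ (br w v) u
        - circ w (br u v) = 0"
    proof (rule trilinear_vanish[OF span_basis, where
          f = "\<lambda>u v w. br (circ w u) v - br (circ w v) u + circ (br w u) v - circ (br w v) u
            - circ w (br u v)"])
      fix b b' b'' assume "b \<in> x ` \<Delta>" "b' \<in> x ` \<Delta>" "b'' \<in> x ` \<Delta>"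
      then show "br (circ b'' b) b' - br (circ b'' b') b + circ (br b'' b) b' - circ (br b'' b') b
          - circ b'' (br b b') = 0"
        by (elim imageE) (simp only: comp)
    qed (use mem in \<open>simp_all add: br.mul_linear mul_linear algebra_simps\<close>)
  qed
qed

section \<open>Existence of a bilinear product with prescribed basis values\<close>

lemma exists_bilinear_extension:
  assumes g: "\<And>\<alpha> \<beta>. \<alpha> \<in> \<Delta> \<Longrightarrow> \<beta> \<in> \<Delta> \<Longrightarrow> g \<alpha> \<beta> \<in> A"
  shows "\<exists>br. complex_algebra scale A br \<and> (\<forall>\<alpha>\<in>\<Delta>. \<forall>\<beta>\<in>\<Delta>. br (x \<alpha>) (x \<beta>) = g \<alpha> \<beta>)"
proof -
  interpret vp: vector_space_pair scale scale ..
  define L where "L h = vp.construct (x ` \<Delta>) (\<lambda>b. h (the_inv_into \<Delta> x b))" for h :: "complex \<Rightarrow> 'v"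
  have L_linear: "L h (u + v) = L h u + L h v" "L h (scale c u) = scale c (L h u)" for h u v c
    using vp.linear_construct[OF independent_basis]
    unfolding L_def by (simp_all add: vp.linear_add vp.linear_scale)
  have L_basis: "L h (x \<alpha>) = h \<alpha>" if "\<alpha> \<in> \<Delta>" for h \<alpha>
    using that vp.construct_basis[OF independent_basis]
    by (simp add: L_def the_inv_into_f_f[OF inj_basis])
  have L_in: "L h u \<in> A" if "\<And>\<alpha>. \<alpha> \<in> \<Delta> \<Longrightarrow> h \<alpha> \<in> A" "u \<in> A" for h u
  proof -
    have "u \<in> span (x ` \<Delta>)" using that span_basis by simp
    then show ?thesis
    proof (induction rule: span_induct_alt)
      case base
      show ?case using L_linear(2)[of h 0 0] subspace_0[OF subspace_carrier] by simp
    next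
      case (step c b v)
      then show ?case using that by (auto simp: L_linear L_basis)
    qed
  qed
  \<comment> \<open>Extend \<open>g \<alpha>\<close> linearly in the second argument, then the
    result linearly in the first; linearity in \<open>u\<close> is thus built in.\<close>
  define br where "br u v = L (\<lambda>\<alpha>. L (g \<alpha>) v) u" for u v
  have br_basis: "br (x \<alpha>) v = L (g \<alpha>) v" if "\<alpha> \<in> \<Delta>" for \<alpha> v
    using that by (simp add: br_def L_basis)
  have br_left: "br (u + u') v = br u v + br u' v" "br (scale c u) v = scale c (br u v)" for u u' v c
    by (simp_all add: br_def L_linear)
  have "complex_algebra scale A br"
  proof
    fix u v w and c :: complex
    assume mem: "u \<in> A" "v \<in> A"
    then show "br u v \<in> A" by (auto simp: br_def intro!: L_in g)
    \<comment> \<open>For a basis vector \<open>u\<close> the product is the linear map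
      \<open>L (g \<alpha>)\<close>; linearity in the second argument then spreads to every
      \<open>u\<close> in \<open>A\<close>.\<close>
    have "br u (scale c v) - scale c (br u v) = 0"
      by (rule vanish_on_span[where B = "x ` \<Delta>" and s = scale and u = u])
        (use mem in \<open>auto simp: span_basis br_left br_basis L_linear algebra_simps\<close>)
    then show "br u (scale c v) = scale c (br u v)" by simp
    have "br u (v + w) - (br u v + br u w) = 0"
      by (rule vanish_on_span[where B = "x ` \<Delta>" and s = scale and u = u])
        (use mem in \<open>auto simp: span_basis br_left br_basis L_linear algebra_simps\<close>)
    then show "br u (v + w) = br u v + br u w" by simp
  qed (auto simp: br_left subspace_carrier)
  moreover have "\<forall>\<alpha>\<in>\<Delta>. \<forall>\<beta>\<in>\<Delta>. br (x \<alpha>) (x \<beta>) = g \<alpha> \<beta>"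
    by (simp add: br_basis L_basis)
  ultimately show ?thesis by blast
qed

end

text \<open>That a formula on the basis defines a bialgebra is split into existence of a bilinear
  product with those values and the laws for every such product, since a total function is not
  determined by its values on \<open>A\<close>.\<close>

theorem theorem4p1:
  fixes scale :: "complex \<Rightarrow> 'v::ab_group_add \<Rightarrow> 'v"
    and A :: "'v set" and circ :: "'v \<Rightarrow> 'v \<Rightarrow> 'v"
    and \<Delta> :: "complex set" and x :: "complex \<Rightarrow> 'v"
  assumes "novikov_Delta scale A circ \<Delta> x"
  shows
    "(\<forall>br. gelfand_dorfman_bialgebra scale A br circ \<longrightarrow>
        (\<exists>a \<phi>. admissible \<Delta> a \<phi> \<and> has_bracket_form scale \<Delta> x a \<phi> br)) \<and>
     (\<forall>a \<phi>. admissible \<Delta> a \<phi> \<longrightarrow>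
        (\<exists>br. complex_algebra scale A br \<and> has_bracket_form scale \<Delta> x a \<phi> br) \<and>
        (\<forall>br. complex_algebra scale A br \<and> has_bracket_form scale \<Delta> x a \<phi> br \<longrightarrow>
           gelfand_dorfman_bialgebra scale A br circ)) \<and>
     (\<forall>\<phi>. skew_symmetric_on \<Delta> \<phi> \<and> Z_bilinear_on \<Delta> \<phi> \<longrightarrow> admissible \<Delta> 0 \<phi>) \<and>
     (\<forall>a \<phi>\<^sub>0. a \<noteq> 0 \<and> additive_map_on \<Delta> \<phi>\<^sub>0 \<longrightarrow>
        admissible \<Delta> a (\<lambda>\<alpha> \<beta>. \<alpha> * \<phi>\<^sub>0 \<beta> - \<beta> * \<phi>\<^sub>0 \<alpha>))"
proof -
  interpret novikov_Delta scale A circ \<Delta> x by fact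
  have "\<exists>br. complex_algebra scale A br \<and> has_bracket_form scale \<Delta> x a \<phi> br" for a \<phi>
    using exists_bilinear_extension[of "\<lambda>\<alpha> \<beta>. scale (\<phi> \<alpha> \<beta> + a * (\<beta> - \<alpha>)) (x (\<alpha> + \<beta>))"]
    unfolding has_bracket_form_def by simp
  then show ?thesis
    using bracket_form_if_bialgebra bialgebra_if_bracket_form admissible_bilinear
      admissible_additive by blast
qed

end
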